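(* Let $N\ge 2$ and let $p$ be the smallest prime not less than $N$. Suppose that user $i$, $i=1,2$, has an available channel set ${\bf c}_i\subseteq\{0,1,\dots,N-1\}$, and that each user uses the ORTHO-CH algorithm (described in the context) with its own available channel set to generate its channel hopping sequence. If there is at least one commonly available channel, i.e., ${\bf c}_1\cap{\bf c}_2\neq\varnothing$, then both users are guaranteed to rendezvous within $(2p+1)p$ time slots for any clock drift $d$ between these two users. That is, letting $c_k(t)$ denote the sequence of user $k$, extended periodically with period $p(2p+1)$, for every integer $d$ and for every possible outcome of the random choices made by the two users, there exists $0\le t\le (2p+1)p-1$ such that $c_1(t)=c_2(t+d)$.
   Context: **ORTHO-CH algorithm.** Input: a nonempty set of available channels ${\bf c}\subseteq\{0,1,\dots,N-1\}$. Output: a periodic sequence with one period $\{c(t),\ t=0,1,\dots,p(2p+1)-1\}$, $c(t)\in{\bf c}$, where $p$ is the smallest prime not less than $N$. 1. If channel $0$ is the only channel in ${\bf c}$, output $c(t)=0$ for all $t$. 2. Otherwise, randomly select a nonzero channel $r$ from ${\bf c}$ (the ID channel). 3. Construct the $p\times p$ matrix $C^{(r)}=(c^{(r)}_{i,j})_{0\le i,j\le p-1}$ with $c^{(r)}_{i,j}=(r\cdot i+j)\bmod p$. 4. Let ${\bf r}$ be the $p\times 1$ column vector with all entries equal to $r$, and form the $p\times(2p+1)$ matrix $\tilde C^{(r)}=(\tilde c^{(r)}_{i,j})=({\bf r}\,|\,C^{(r)}\,|\,C^{(r)})$ by concatenation (rows indexed $0,\dots,p-1$, columns indexed $0,\dots,2p$).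 5. For $t=0,1,\dots,p(2p+1)-1$, let $c(t)=\tilde c^{(r)}_{i,j}$ with $i=\lfloor t/(2p+1)\rfloor$ and $j=(t\bmod(2p+1))$. 6. For each $t$ with $c(t)\notin{\bf c}$, replace $c(t)$ by a randomly chosen channel in ${\bf c}$. The random choices of the two users in steps 2 and 6 are arbitrary (each user makes its own choices). Two users rendezvous at a time slot if they hop on the same channel in that slot. *)

theory Defs
  imports "HOL-Number_Theory.Number_Theory"
begin

definition least_prime_ge :: "nat \<Rightarrow> nat" where
  "least_prime_ge N = (LEAST p. prime p \<and> N \<le> p)"

text \<open>Matrices are functions of a row and a column index, both counted from 0; entries
  outside the index ranges stated below are irrelevant.\<close>

text \<open>The \<open>p \<times> p\<close> matrix \<open>C\<close> built from the ID channel \<open>r\<close>.\<close>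

definition id_matrix :: "nat \<Rightarrow> nat \<Rightarrow> nat \<Rightarrow> nat \<Rightarrow> nat" where
  "id_matrix p r i j = (r * i + j) mod p"

text \<open>The \<open>p \<times> (2 * p + 1)\<close> concatenation (\<open>r\<close> | \<open>C\<close> | \<open>C\<close>): column 0 is the constant
  \<open>r\<close>, columns \<open>1..p\<close> and \<open>p + 1..2 * p\<close> are the two copies of \<open>C\<close>.\<close>

definition ext_matrix :: "nat \<Rightarrow> nat \<Rightarrow> nat \<Rightarrow> nat \<Rightarrow> nat" where
  "ext_matrix p r i j =
     (if j = 0 then r
      else if j \<le> p then id_matrix p r i (j - 1)
      else id_matrix p r i (j - (p + 1)))"

definition ortho_period :: "nat \<Rightarrow> nat" where
  "ortho_period p = p * (2 * p + 1)"

text \<open>The sequence before unavailable channels are replaced.\<close>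

definition raw_seq :: "nat \<Rightarrow> nat \<Rightarrow> nat \<Rightarrow> nat" where
  "raw_seq p r t = ext_matrix p r (t div (2 * p + 1)) (t mod (2 * p + 1))"

text \<open>The algorithm is randomized, so it is given as a relation: \<open>ortho_ch_output N \<c> s\<close>
  says that the values of \<open>s\<close> on \<open>{0..<ortho_period p}\<close> are one period of a possible output
  on the available set \<open>\<c>\<close>. The quantifier over \<open>r\<close> ranges over the choices of the ID
  channel; every slot holding an unavailable channel gets its own arbitrary replacement.\<close>

definition ortho_ch_output :: "nat \<Rightarrow> nat set \<Rightarrow> (nat \<Rightarrow> nat) \<Rightarrow> bool" where
  "ortho_ch_output N \<c> s \<longleftrightarrow>
     (let p = least_prime_ge N in
      if \<c> = {0} then \<forall>t < ortho_period p. s t = 0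
      else \<exists>r \<in> \<c>. r \<noteq> 0 \<and>
             (\<forall>t < ortho_period p.
                if raw_seq p r t \<in> \<c> then s t = raw_seq p r t else s t \<in> \<c>))"

text \<open>The extension to all integer times, with period \<open>T\<close>, of the values of \<open>s\<close> on
  \<open>{0..<T}\<close>.\<close>

definition periodic_ext :: "nat \<Rightarrow> (nat \<Rightarrow> nat) \<Rightarrow> int \<Rightarrow> nat" where
  "periodic_ext T s t = s (nat (t mod int T))"

end

theory Submission
  imports Defs
begin

text \<open>Write \<open>L = 2 * p + 1\<close> for the row length. As \<open>L\<close> is 1 modulo \<open>p\<close>, every slot
  \<open>i * L + j\<close> with \<open>0 < j < L\<close> holds \<open>r * i + j - 1\<close> modulo \<open>p\<close>, in both copies of the
  matrix. Split the drift as \<open>d = a * L + b\<close>. If the two ID channels differ, a row \<open>i\<close>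
  in which the two matrices agree along the shifted diagonal is found by solving a linear
  congruence; the overlap of the matrix parts of the two rows has at least \<open>p\<close> columns
  (without wrapping into the next row if \<open>b \<le> p\<close>, with wrapping otherwise), so it meets
  every channel. If the ID channels coincide, that common channel sits in column 0 of every
  row of the first user, and the second user meets it in one of the slots \<open>i * L + d\<close>.\<close>

lemma least_prime_ge:
  shows prime_least_prime_ge: "prime (least_prime_ge N)"
    and least_prime_ge_ge: "N \<le> least_prime_ge N"
proof -
  obtain q where "prime q" "N < q"
    using bigger_prime by blast
  then have "prime q \<and> N \<le> q" by simp
  then have "prime (least_prime_ge N) \<and> N \<le> least_prime_ge N"
    unfolding least_prime_ge_def by (rule LeastI)
  then show "prime (least_prime_ge N)" "N \<le> least_prime_ge N" by auto
qed

section \<open>Slots in row and column coordinates, extended to all integers\<close>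

lemma periodic_ext_mod:
  "periodic_ext T s (t mod int T) = periodic_ext T s t"
  by (simp add: periodic_ext_def)

lemma raw_seq_first_column: "raw_seq p r (i * (2 * p + 1)) = r"
  unfolding raw_seq_def ext_matrix_def by (simp only: mod_mult_self2_is_0 simp_thms if_True)

lemma raw_seq_inner_column:
  assumes "0 < j" and "j < 2 * p + 1"
  shows "raw_seq p r (i * (2 * p + 1) + j) = (r * i + (j - 1)) mod p"
proof -
  have "(i * (2 * p + 1) + j) div (2 * p + 1) = i"
    using assms by (metis add.right_neutral div_less div_mult_self3 not_less_zero)
  moreover have "(i * (2 * p + 1) + j) mod (2 * p + 1) = j"
    using assms by (metis mod_less mod_mult_self3)
  \<comment> \<open>In the second copy the column offset is smaller by exactly \<open>p\<close>,
    which vanishes modulo \<open>p\<close>.\<close>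
  moreover have "(r * i + (j - (p + 1))) mod p = (r * i + (j - 1)) mod p" if "\<not> j \<le> p"
  proof -
    have "r * i + (j - 1) = r * i + (j - (p + 1)) + p" using that by simp
    then show ?thesis by (metis mod_add_self2)
  qed
  ultimately show ?thesis
    using assms unfolding raw_seq_def ext_matrix_def id_matrix_def by auto
qed

text \<open>A period consists of \<open>p\<close> rows of length \<open>2 * p + 1\<close>, so
  reducing a slot modulo the period reduces its row modulo \<open>p\<close> and keeps its column.
  Rows may therefore be arbitrary integers from here on.\<close>

lemma nat_mod_ortho_period:
  assumes "0 \<le> j" and "j < int (2 * p + 1)" and "0 < p"
  shows "nat ((i * int (2 * p + 1) + j) mod int (ortho_period p))
    = nat (i mod int p) * (2 * p + 1) + nat j"
proof -
  let ?L = "int (2 * p + 1)"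
  have "(i * ?L + j) mod (?L * int p)
      = ?L * ((i * ?L + j) div ?L mod int p) + (i * ?L + j) mod ?L"
    by (rule zmod_zmult2_eq) simp
  also have "(i * ?L + j) div ?L = i" using assms by simp
  also have "(i * ?L + j) mod ?L = j" using assms by simp
  finally have "(i * ?L + j) mod int (ortho_period p) = (i mod int p) * ?L + j"
    unfolding ortho_period_def by (simp only: of_nat_mult mult.commute)
  moreover have "(i mod int p) * ?L + j
      = int (nat (i mod int p) * (2 * p + 1) + nat j)"
    using assms by (simp add: distrib_left)
  ultimately show ?thesis by (metis nat_int)
qed

lemma periodic_raw_seq_first_column:
  assumes "0 < p"
  shows "periodic_ext (ortho_period p) (raw_seq p r) (i * int (2 * p + 1)) = r"
  using nat_mod_ortho_period[of 0 p i] assms raw_seq_first_column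
  by (simp add: periodic_ext_def)

text \<open>The entry depends on the row only modulo \<open>p\<close>, so a congruence in the
  unreduced row \<open>i\<close> determines it, and \<open>c < p\<close> turns that congruence into
  an equality.\<close>

lemma periodic_raw_seq_inner_column:
  assumes "0 < j" and "j < int (2 * p + 1)" and "0 < p" and "c < p"
    and "[int r * i + j - 1 = int c] (mod int p)"
  shows "periodic_ext (ortho_period p) (raw_seq p r) (i * int (2 * p + 1) + j) = c"
proof -
  let ?k = "nat (i mod int p)"
  have "periodic_ext (ortho_period p) (raw_seq p r) (i * int (2 * p + 1) + j)
      = (r * ?k + (nat j - 1)) mod p"
    using assms nat_mod_ortho_period[of j p i] raw_seq_inner_column[of "nat j" p r ?k]
    by (simp add: periodic_ext_def)
  moreover have "int ((r * ?k + (nat j - 1)) mod p) = int c"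
  proof -
    have "int (r * ?k + (nat j - 1)) = int r * (i mod int p) + (j - 1)"
      using assms by (simp add: of_nat_diff)
    moreover have "[int r * (i mod int p) + (j - 1) = int r * i + (j - 1)] (mod int p)"
      by (intro cong_add cong_mult) simp_all
    ultimately have "[int (r * ?k + (nat j - 1)) = int c] (mod int p)"
      using assms(5) by (metis add_diff_eq cong_trans)
    then show ?thesis
      using assms(4) by (simp add: cong_def zmod_int)
  qed
  ultimately show ?thesis by simp
qed

section \<open>Linear congruences and common entries of shifted raw sequences\<close>

lemma linear_cong_solvable_prime:
  fixes k m :: int
  assumes "prime p" and "\<not> int p dvd k"
  obtains i where "[k * i = m] (mod int p)"
proof -
  have "coprime k (int p)"
    using assms by (metis coprime_commute prime_imp_coprime prime_nat_int_transfer)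
  then obtain x where "[k * x = 1] (mod int p)"
    using cong_solve_coprime_int by blast
  then have "[k * x * m = 1 * m] (mod int p)"
    by (rule cong_scalar_right)
  then show ?thesis
    using that[of "x * m"] by (simp add: mult.assoc)
qed

text \<open>The slots considered all lie in one column \<open>b\<close>, in rows
  \<open>i + a\<close>. Column 0 is constantly \<open>r\<close>; down any other column the entry
  grows by \<open>r\<close> per row, and \<open>r\<close> is invertible modulo \<open>p\<close>, so
  every residue occurs.\<close>

lemma raw_seq_hits_id_channel:
  assumes "prime p" and "0 < r" and "r < p"
  shows "\<exists>i. periodic_ext (ortho_period p) (raw_seq p r) (i * int (2 * p + 1) + d) = r"
proof -
  let ?L = "int (2 * p + 1)"
  define a b where "a = d div ?L" and "b = d mod ?L"
  have d: "d = a * ?L + b" unfolding a_def b_def by (rule div_mult_mod_eq[symmetric])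
  have b: "0 \<le> b" "b < ?L" unfolding b_def by simp_all
  have p: "0 < p" using assms by simp
  have shift: "i * ?L + d = (i + a) * ?L + b" for i
    using d by (simp add: algebra_simps)
  show ?thesis
  proof (cases "b = 0")
    case True
    then show ?thesis
      using shift periodic_raw_seq_first_column[OF p] by (metis add.right_neutral)
  next
    case False
    have "\<not> int p dvd int r"
      using assms by (simp add: nat_dvd_not_less)
    then obtain k where k: "[int r * k = int r - b + 1] (mod int p)"
      using linear_cong_solvable_prime assms(1) by blast
    then have "[int r * k + (b - 1) = int r - b + 1 + (b - 1)] (mod int p)"
      by (intro cong_add) simp_all
    then have "periodic_ext (ortho_period p) (raw_seq p r) (k * ?L + b) = r"
      using b False p assms by (intro periodic_raw_seq_inner_column) (auto simp: algebra_simps)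
    \<comment> \<open>\<open>k\<close> is the row after the shift, hence the unshifted row is
      \<open>k - a\<close>.\<close>
    then show ?thesis
      using shift[of "k - a"] by (intro exI[of _ "k - a"]) simp
  qed
qed

text \<open>Modulo \<open>p\<close>, the entries of row \<open>i\<close> for \<open>r\<close> and of
  row \<open>i + a'\<close> for \<open>r'\<close>, compared at a column offset \<open>b'\<close>,
  differ by \<open>(r' - r) * i + r' * a' + b'\<close>. This does not depend on the column, so
  \<open>i\<close> can be chosen to cancel it, and the column is still free to produce
  \<open>c\<close>.\<close>

lemma raw_seqs_meet_everywhere:
  assumes "prime p" and "r < p" and "r' < p" and "r \<noteq> r'" and "c < p"
  shows "\<exists>t. periodic_ext (ortho_period p) (raw_seq p r) t = c
           \<and> periodic_ext (ortho_period p) (raw_seq p r') (t + d) = c"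
proof -
  let ?L = "int (2 * p + 1)"
  define a b where "a = d div ?L" and "b = d mod ?L"
  have d: "d = a * ?L + b" unfolding a_def b_def by (rule div_mult_mod_eq[symmetric])
  have b: "0 \<le> b" "b < ?L" unfolding b_def by simp_all
  have p: "0 < p" using assms by simp
  have ndvd: "\<not> int p dvd int r' - int r"
  proof
    assume "int p dvd int r' - int r"
    then have "[int r' = int r] (mod int p)" by (simp add: cong_iff_dvd_diff)
    then show False using assms by (simp add: cong_def)
  qed
  \<comment> \<open>The splitting of \<open>d\<close> is left open because \<open>b'\<close> will be
    negative in one case. The strict bounds keep both columns inside their rows and off the constant
    column 0.\<close>
  have meet: "periodic_ext (ortho_period p) (raw_seq p r) (i * ?L + j) = c
      \<and> periodic_ext (ortho_period p) (raw_seq p r') (i * ?L + j + d) = c"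
    if i: "[(int r' - int r) * i = - (int r' * a' + b')] (mod int p)"
      and j: "[j = int c + 1 - int r * i] (mod int p)"
      and bounds: "0 < j" "j < ?L" "0 < j + b'" "j + b' < ?L"
      and d': "d = a' * ?L + b'" for i j a' b'
  proof -
    have "[int r * i + (j - 1) = int r * i + (int c + 1 - int r * i - 1)] (mod int p)"
      using j by (intro cong_add cong_diff) simp_all
    then have first: "[int r * i + j - 1 = int c] (mod int p)"
      by (simp add: algebra_simps)
    have "[(int r' - int r) * i + (int r * i + j - 1) + (int r' * a' + b')
        = - (int r' * a' + b') + int c + (int r' * a' + b')] (mod int p)"
      using i first by (intro cong_add) simp_all
    then have second: "[int r' * (i + a') + (j + b') - 1 = int c] (mod int p)"
      by (simp add: algebra_simps)
    have "i * ?L + j + d = (i + a') * ?L + (j + b')"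
      using d' by (simp add: algebra_simps)
    then show ?thesis
      using first second bounds p assms(5) periodic_raw_seq_inner_column by metis
  qed
  have "\<exists>i j a' b'. [(int r' - int r) * i = - (int r' * a' + b')] (mod int p)
      \<and> [j = int c + 1 - int r * i] (mod int p)
      \<and> 0 < j \<and> j < ?L \<and> 0 < j + b' \<and> j + b' < ?L \<and> d = a' * ?L + b'"
  proof (cases "b \<le> int p")
    case True
    obtain i where i: "[(int r' - int r) * i = - (int r' * a + b)] (mod int p)"
      using linear_cong_solvable_prime[OF assms(1) ndvd] by blast
    \<comment> \<open>The column \<open>1 + m\<close> ranges over \<open>1..p\<close>, so its shift
      by \<open>b \<le> p\<close> is at most \<open>2 * p\<close>.\<close>
    define m where "m = (int c - int r * i) mod int p"
    have m: "0 \<le> m" "m < int p" using p unfolding m_def by simp_all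
    have "[1 + m = 1 + (int c - int r * i)] (mod int p)"
      unfolding m_def by (intro cong_add) simp_all
    then have "[1 + m = int c + 1 - int r * i] (mod int p)" by (simp add: algebra_simps)
    then show ?thesis
      using i m b d True
      by (intro exI[of _ i] exI[of _ "1 + m"] exI[of _ a] exI[of _ b]) auto
  next
    case False
    \<comment> \<open>Here \<open>b\<close> is replaced by \<open>b - ?L\<close>, which lies between
      \<open>-p\<close> and \<open>-1\<close>, with one more row of drift. Columns
      \<open>p + 1..2 * p\<close> then stay positive after the shift.\<close>
    obtain i where i:
      "[(int r' - int r) * i = - (int r' * (a + 1) + (b - ?L))] (mod int p)"
      using linear_cong_solvable_prime[OF assms(1) ndvd] by blast
    define m where "m = (int c - int r * i) mod int p"
    have m: "0 \<le> m" "m < int p" using p unfolding m_def by simp_all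
    have "[int p + (1 + m) = 0 + (1 + (int c - int r * i))] (mod int p)"
      unfolding m_def by (intro cong_add) (simp_all add: cong_def)
    then have "[int p + 1 + m = int c + 1 - int r * i] (mod int p)"
      by (simp add: algebra_simps)
    moreover have "d = (a + 1) * ?L + (b - ?L)" using d by (simp add: algebra_simps)
    moreover have "0 < int p + 1 + m" "int p + 1 + m < ?L"
      "0 < int p + 1 + m + (b - ?L)" "int p + 1 + m + (b - ?L) < ?L"
      using m b False by simp_all
    ultimately show ?thesis using i by blast
  qed
  then show ?thesis using meet by blast
qed

section \<open>From raw sequences to outputs with random choices\<close>

lemma ortho_ch_output_singleton_zero:
  assumes "ortho_ch_output N {0} s" and "p = least_prime_ge N"
  shows "periodic_ext (ortho_period p) s t = 0"
proof -
  have "0 < ortho_period p"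
    using prime_least_prime_ge[of N] assms(2) prime_gt_0_nat by (simp add: ortho_period_def)
  then show ?thesis
    using assms by (simp add: ortho_ch_output_def Let_def periodic_ext_def nat_less_iff)
qed

text \<open>This isolates what survives the random replacements: raw entries that are available stay
  untouched.\<close>

lemma ortho_ch_output_id_channel:
  assumes "ortho_ch_output N C s" and "p = least_prime_ge N" and "C \<noteq> {0}"
  obtains r where "r \<in> C" and "0 < r"
    and "\<And>t. periodic_ext (ortho_period p) (raw_seq p r) t \<in> C \<Longrightarrow>
           periodic_ext (ortho_period p) s t = periodic_ext (ortho_period p) (raw_seq p r) t"
proof -
  obtain r where r: "r \<in> C" "r \<noteq> 0"
    "\<And>t. t < ortho_period p \<Longrightarrow> raw_seq p r t \<in> C \<Longrightarrow> s t = raw_seq p r t"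
    using assms(1) unfolding ortho_ch_output_def Let_def if_not_P[OF assms(3)] assms(2)[symmetric]
    by metis
  have "0 < ortho_period p"
    using prime_least_prime_ge[of N] assms(2) prime_gt_0_nat by (simp add: ortho_period_def)
  then show ?thesis
    using that[of r] r by (simp add: periodic_ext_def nat_less_iff)
qed

text \<open>Needed to meet a user who always stays on channel 0. For every ID channel, row 0 and
  column 1 hold the raw entry 0, which is kept when 0 is available.\<close>

lemma ortho_ch_output_hits_zero:
  assumes "ortho_ch_output N C s" and "p = least_prime_ge N" and "0 \<in> C"
  shows "\<exists>t. periodic_ext (ortho_period p) s t = 0"
proof (cases "C = {0}")
  case True
  then show ?thesis using assms ortho_ch_output_singleton_zero by blast
next
  case False
  then obtain r where r:
    "\<And>t. periodic_ext (ortho_period p) (raw_seq p r) t \<in> C \<Longrightarrow>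
       periodic_ext (ortho_period p) s t = periodic_ext (ortho_period p) (raw_seq p r) t"
    using ortho_ch_output_id_channel assms by metis
  have "0 < p" using prime_least_prime_ge[of N] assms(2) prime_gt_0_nat by simp
  then have "periodic_ext (ortho_period p) (raw_seq p r) (0 * int (2 * p + 1) + 1) = 0"
    by (intro periodic_raw_seq_inner_column) auto
  then show ?thesis using r assms(3) by metis
qed

theorem theorem13:
  fixes N p :: nat and \<c>\<^sub>1 \<c>\<^sub>2 :: "nat set" and s\<^sub>1 s\<^sub>2 :: "nat \<Rightarrow> nat" and d :: int
  assumes "N \<ge> 2"
    and "p = least_prime_ge N"
    and "\<c>\<^sub>1 \<subseteq> {0..N - 1}" and "\<c>\<^sub>2 \<subseteq> {0..N - 1}"
    and "ortho_ch_output N \<c>\<^sub>1 s\<^sub>1" and "ortho_ch_output N \<c>\<^sub>2 s\<^sub>2"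
    and "\<c>\<^sub>1 \<inter> \<c>\<^sub>2 \<noteq> {}"
  shows "\<exists>t::int. 0 \<le> t \<and> t \<le> int ((2 * p + 1) * p) - 1 \<and>
           periodic_ext (ortho_period p) s\<^sub>1 t = periodic_ext (ortho_period p) s\<^sub>2 (t + d)"
proof -
  let ?T = "ortho_period p"
  have p: "prime p" "N \<le> p"
    using least_prime_ge[of N] assms(2) by simp_all
  have less_p: "c < p" if "c \<in> \<c>\<^sub>1 \<union> \<c>\<^sub>2" for c
    using that assms(1,3,4) p(2) by fastforce
  have "\<exists>t. periodic_ext ?T s\<^sub>1 t = periodic_ext ?T s\<^sub>2 (t + d)"
  proof (cases "\<c>\<^sub>1 = {0} \<or> \<c>\<^sub>2 = {0}")
    case True
    then have "0 \<in> \<c>\<^sub>1" "0 \<in> \<c>\<^sub>2" using assms(7) by auto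
    then obtain t\<^sub>1 t\<^sub>2 where "periodic_ext ?T s\<^sub>1 t\<^sub>1 = 0" "periodic_ext ?T s\<^sub>2 t\<^sub>2 = 0"
      using ortho_ch_output_hits_zero assms(2,5,6) by metis
    \<comment> \<open>One sequence is constantly 0, so a zero of the other one suffices; a zero of
      the second user at \<open>t\<^sub>2\<close> corresponds to the slot
      \<open>t\<^sub>2 - d\<close>.\<close>
    then show ?thesis
      using True ortho_ch_output_singleton_zero assms(2,5,6) by (metis diff_add_cancel)
  next
    case False
    obtain r\<^sub>1 where r1: "r\<^sub>1 \<in> \<c>\<^sub>1" "0 < r\<^sub>1"
      "\<And>t. periodic_ext ?T (raw_seq p r\<^sub>1) t \<in> \<c>\<^sub>1 \<Longrightarrow>
         periodic_ext ?T s\<^sub>1 t = periodic_ext ?T (raw_seq p r\<^sub>1) t"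
      using ortho_ch_output_id_channel[OF assms(5,2)] False by metis
    obtain r\<^sub>2 where r2: "r\<^sub>2 \<in> \<c>\<^sub>2" "0 < r\<^sub>2"
      "\<And>t. periodic_ext ?T (raw_seq p r\<^sub>2) t \<in> \<c>\<^sub>2 \<Longrightarrow>
         periodic_ext ?T s\<^sub>2 t = periodic_ext ?T (raw_seq p r\<^sub>2) t"
      using ortho_ch_output_id_channel[OF assms(6,2)] False by metis
    \<comment> \<open>A raw meeting on a common channel is enough, since neither user replaces
      it.\<close>
    have "\<exists>t c. c \<in> \<c>\<^sub>1 \<inter> \<c>\<^sub>2 \<and> periodic_ext ?T (raw_seq p r\<^sub>1) t = c
        \<and> periodic_ext ?T (raw_seq p r\<^sub>2) (t + d) = c"
    proof (cases "r\<^sub>1 = r\<^sub>2")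
      case True
      then obtain i where
        "periodic_ext ?T (raw_seq p r\<^sub>2) (i * int (2 * p + 1) + d) = r\<^sub>1"
        using raw_seq_hits_id_channel p(1) r1 less_p by blast
      then show ?thesis
        using True r1(1) r2(1) periodic_raw_seq_first_column[OF prime_gt_0_nat[OF p(1)]]
        by (intro exI[of _ "i * int (2 * p + 1)"] exI[of _ r\<^sub>1]) simp_all
    next
      case False
      obtain c where "c \<in> \<c>\<^sub>1 \<inter> \<c>\<^sub>2" using assms(7) by blast
      then show ?thesis
        using raw_seqs_meet_everywhere[OF p(1) _ _ False] less_p r1(1) r2(1) by blast
    qed
    then show ?thesis using r1(3) r2(3) by (metis IntE)
  qed
  then obtain t where t: "periodic_ext ?T s\<^sub>1 t = periodic_ext ?T s\<^sub>2 (t + d)" by blast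
  \<comment> \<open>Both extensions have period \<open>?T\<close>, so the integer slot
    \<open>t\<close> can be moved into one period with the same drift.\<close>
  have "int ((2 * p + 1) * p) = int ?T" by (simp add: ortho_period_def mult.commute)
  moreover have "0 < int ?T"
    using prime_gt_0_nat[OF p(1)] by (simp add: ortho_period_def add_pos_nonneg)
  moreover have "periodic_ext ?T s\<^sub>1 (t mod int ?T) = periodic_ext ?T s\<^sub>2 (t mod int ?T + d)"
    using t periodic_ext_mod by (metis mod_add_left_eq)
  ultimately show ?thesis
    by (intro exI[of _ "t mod int ?T"]) simp
qed

end
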